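(* For every integer $n\ge 1$, $|\mathcal{S}_n(23;\,1\to 3)| = C_n$, where $C_n=\frac{1}{n+1}\binom{2n}{n}$ is the $n$-th Catalan number.
   Context: $[n]=\{1,\dots,n\}$, and $\mathcal{S}_n$ is the set of permutations $\pi=\pi_1\pi_2\cdots\pi_n$ of $[n]$ in one-line notation. The permutation $\hat\pi$: for $\pi\in\mathcal{S}_n$, $\hat\pi\in\mathcal{S}_n$ is the permutation whose cycle form is obtained from the word $\pi_1\cdots\pi_n$ by inserting a left parenthesis before each left-to-right maximum (an entry larger than all entries to its left) and a right parenthesis immediately before the next left-to-right maximum, or at the end of the word. A cycle $(c_1,c_2,\dots,c_s)$ means $c_1\mapsto c_2\mapsto\cdots\mapsto c_s\mapsto c_1$. Example: if $\pi=2537164$ then $\hat\pi=(2)(53)(7164)$. Arrow patterns: an arrow pattern of size $k$ is a pair $(\nu;H)$ where $\nu=\nu_1\cdots\nu_m$ is a word of distinct positive integers, $H$ is a collection of arrows $b_i\to c_i$, and the set of all integers appearing in $\nu$ or $H$ is $[k]$. A permutation $\pi\in\mathcal{S}_n$ contains $(\nu;H)$ if there are a set $X=\{x_1<x_2<\cdots<x_k\}\subseteq[n]$ and indices $t_1<\cdots<t_m$ such that $\pi_{t_1}\pi_{t_2}\cdots\pi_{t_m}=x_{\nu_1}x_{\nu_2}\cdots x_{\nu_m}$ and $\hat\pi(x_{b_i})=x_{c_i}$ for every arrow $b_i\to c_i$ in $H$. Otherwise $\pi$ avoids $(\nu;H)$. $\mathcal{S}_n(\nu;H)$ is the set of permutations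 in $\mathcal{S}_n$ avoiding $(\nu;H)$. *)

theory Defs
  imports Complex_Main "HOL-Combinatorics.Combinatorics"
begin

text \<open>
  A permutation \<open>\<pi>\<close> of \<open>{1..n}\<close> in one-line notation is a list
  \<open>\<pi> \<in> permutations_of_set {1..n}\<close>; list positions are counted from 0.
\<close>

text \<open>
  Cutting a word of distinct numbers before each left-to-right maximum: the first letter is
  a left-to-right maximum, and the next one is the first later letter that exceeds it.
\<close>

function lr_max_blocks :: "nat list \<Rightarrow> nat list list" where
  "lr_max_blocks [] = []"
| "lr_max_blocks (x # xs) =
     (x # takeWhile (\<lambda>y. y < x) xs) # lr_max_blocks (dropWhile (\<lambda>y. y < x) xs)"
  by pat_completeness auto
termination
  by (relation "measure length") (auto simp: le_imp_less_Suc length_dropWhile_le)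

text \<open>
  The permutation whose disjoint cycles are the blocks, where \<open>cycle_of_list [c\<^sub>1, \<dots>, c\<^sub>s]\<close>
  maps \<open>c\<^sub>1 \<mapsto> c\<^sub>2 \<mapsto> \<dots> \<mapsto> c\<^sub>s \<mapsto> c\<^sub>1\<close>.
\<close>

definition hat :: "nat list \<Rightarrow> nat \<Rightarrow> nat" where
  "hat \<pi> = foldr (\<lambda>c f. cycle_of_list c \<circ> f) (lr_max_blocks \<pi>) id"

lemma "lr_max_blocks [2, 5, 3, 7, 1, 6, 4] = [[2], [5, 3], [7, 1, 6, 4]]"
  by simp

lemma "map (hat [2, 5, 3, 7, 1, 6, 4]) [1, 2, 3, 4, 5, 6, 7] = [6, 2, 5, 7, 3, 4, 1]"
  by (simp add: hat_def transpose_def)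

text \<open>
  A pair \<open>(\<nu>, H)\<close>, with an arrow \<open>b \<rightarrow> c\<close> represented by \<open>(b, c) \<in> H\<close>.
\<close>

type_synonym arrow_pattern = "nat list \<times> (nat \<times> nat) set"

fun pattern_letters :: "arrow_pattern \<Rightarrow> nat set" where
  "pattern_letters (\<nu>, H) = set \<nu> \<union> fst ` H \<union> snd ` H"

definition is_arrow_pattern :: "nat \<Rightarrow> arrow_pattern \<Rightarrow> bool" where
  "is_arrow_pattern k P \<longleftrightarrow> distinct (fst P) \<and> pattern_letters P = {1..k}"

text \<open>
  The size \<open>k\<close> of an arrow pattern is determined by the pattern, see \<open>pattern_size_eq\<close>.
\<close>

definition pattern_size :: "arrow_pattern \<Rightarrow> nat" where
  "pattern_size P = card (pattern_letters P)"

lemma pattern_size_eq: "is_arrow_pattern k P \<Longrightarrow> pattern_size P = k"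
  by (simp add: is_arrow_pattern_def pattern_size_def)

lemma "is_arrow_pattern 3 ([2, 3], {(1, 3)})"
  by (auto simp: is_arrow_pattern_def)

text \<open>
  The set \<open>X = {x\<^sub>1 < \<dots> < x\<^sub>k}\<close> is given by its increasing enumeration \<open>x\<close> on \<open>{1..k}\<close>,
  the indices \<open>t\<^sub>1 < \<dots> < t\<^sub>m\<close> by an increasing map \<open>t\<close> on list positions.
\<close>

fun contains_pattern :: "nat list \<Rightarrow> arrow_pattern \<Rightarrow> bool" where
  "contains_pattern \<pi> (\<nu>, H) \<longleftrightarrow>
     (\<exists>x t. strict_mono_on {1..pattern_size (\<nu>, H)} x \<and>
            x ` {1..pattern_size (\<nu>, H)} \<subseteq> {1..length \<pi>} \<and>
            strict_mono_on {..<length \<nu>} t \<and>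
            t ` {..<length \<nu>} \<subseteq> {..<length \<pi>} \<and>
            (\<forall>j<length \<nu>. \<pi> ! t j = x (\<nu> ! j)) \<and>
            (\<forall>(b, c)\<in>H. hat \<pi> (x b) = x c))"

definition avoiders :: "nat \<Rightarrow> arrow_pattern \<Rightarrow> nat list set" where
  "avoiders n P = {\<pi> \<in> permutations_of_set {1..n}. \<not> contains_pattern \<pi> P}"

definition catalan :: "nat \<Rightarrow> real" where
  "catalan n = 1 / (real n + 1) * real ((2 * n) choose n)"

end

(*
  Write a permutation as u n v, cut at its maximal letter n, so that n v is the last block. The
  last letter of v is sent to n, and an adjacent ascent in v is an arrow. Hence, if some letter
  of v is smaller than a letter s of u, either the last letter of v is, or v has an adjacent
  ascent from below s to above s; both produce the pattern. For the same reason v must avoid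
  the classical pattern 213. Thus u n v is an avoider iff u is one, v avoids 213 and u lies
  below v. Cutting a 213-avoider at its minimal letter gives a decomposition of the same kind,
  so both counting sequences satisfy the Catalan recurrence.
*)

theory Submission
  imports Defs "HOL-Library.Sublist" "HOL-Computational_Algebra.Formal_Power_Series"
begin

section \<open>The Catalan recurrence\<close>

lemma catalan_0 [simp]: "catalan 0 = 1"
  by (simp add: catalan_def)

text \<open>Both sides equal \<open>2 * ((2 * n + 1) choose n)\<close>: absorption links this
  coefficient to the central ones in rows \<open>2 * n\<close> and \<open>2 * n + 2\<close>.\<close>

lemma catalan_Suc_ratio: "(real n + 2) * catalan (Suc n) = (4 * real n + 2) * catalan n"
proof -
  have "real (Suc (2 * n)) * ((2 * n) choose n) = real ((2 * n + 1) choose n) * (n + 1)"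
    using binomial_absorb_comp[of "Suc (2 * n)" n] Suc_times_binomial_eq[of "2 * n" n]
    by (metis Suc_eq_plus1 diff_Suc_1 of_nat_mult binomial_symmetric mult.commute add_diff_cancel_right'
        le_add2 mult_2 Suc_diff_le)
  then have B: "(2 * real n + 1) * ((2 * n) choose n) = real ((2 * n + 1) choose n) * (real n + 1)"
    by (simp add: algebra_simps)
  have "real (Suc (Suc (2 * n)) choose Suc n) * (real n + 1) = 2 * real ((2 * n + 1) choose n) * (real n + 1)"
    using arg_cong[OF Suc_times_binomial_eq[of "Suc (2 * n)" n], of real]
    by (simp add: algebra_simps del: binomial_Suc_Suc)
  then have D: "real (Suc (Suc (2 * n)) choose Suc n) = 2 * real ((2 * n + 1) choose n)"
    by simp
  have "(real n + 2) * catalan (Suc n) = 2 * real ((2 * n + 1) choose n)"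
    unfolding catalan_def using D by (simp add: field_simps del: binomial_Suc_Suc)
  also have "\<dots> = 2 * ((2 * real n + 1) * ((2 * n) choose n)) / (real n + 1)"
    unfolding B by simp
  also have "\<dots> = (4 * real n + 2) * catalan n"
    unfolding catalan_def by (simp add: algebra_simps)
  finally show ?thesis .
qed

text \<open>The right side is the coefficient of x^n in (1 - sqrt (1 - 4 x)) / (2 x), by the
  binomial series. It satisfies the recurrence \<open>catalan_Suc_ratio\<close>, as absorption for
  \<open>gchoose\<close> shows.\<close>

lemma catalan_gbinomial: "catalan n = 2 * (- 4) ^ n * ((1 / 2) gchoose Suc n)"
proof (induction n)
  case (Suc n)
  have "(real n + 2) * ((1 / 2) gchoose Suc (Suc n)) = (- 1 / 2 - real n) * ((1 / 2) gchoose Suc n)"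
    using gbinomial_absorb_comp[of "1/2 :: real" "Suc n"] gbinomial_absorption[of "Suc n" "1/2 :: real"]
    by (simp add: algebra_simps)
  then have "2 * (- 4) ^ Suc n * ((real n + 2) * ((1 / 2) gchoose Suc (Suc n)))
      = 2 * (- 4) ^ Suc n * ((- 1 / 2 - real n) * ((1 / 2) gchoose Suc n))"
    by simp
  also have "\<dots> = (4 * real n + 2) * (2 * (- 4) ^ n * ((1 / 2) gchoose Suc n))"
    by (simp add: algebra_simps)
  also have "\<dots> = (real n + 2) * catalan (Suc n)"
    by (simp only: Suc catalan_Suc_ratio)
  finally have "(real n + 2) * catalan (Suc n) = (real n + 2) * (2 * (- 4) ^ Suc n * ((1 / 2) gchoose Suc (Suc n)))"
    by (simp only: mult_ac)
  then show ?case
    by (metis mult_cancel_left of_nat_0_le_iff add_nonneg_pos less_irrefl zero_less_numeral)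
qed simp

text \<open>
  By \<open>catalan_gbinomial\<close>, this is Vandermonde's identity for \<open>1 / 2 + 1 / 2 = 1\<close>, whose sum
  vanishes in all degrees above 1.
\<close>

lemma catalan_Suc: "catalan (Suc n) = (\<Sum>i\<le>n. catalan i * catalan (n - i))"
proof -
  define h where "h k = ((1 / 2 :: real) gchoose k)" for k
  have "0 = ((1 / 2 + 1 / 2 :: real) gchoose (n + 2))"
    using binomial_gbinomial[of 1 "n + 2", where ?'a = real] by simp
  also have "\<dots> = (\<Sum>k\<le>Suc (Suc n). h k * h (n + 2 - k))"
    by (simp only: gbinomial_Vandermonde[symmetric] h_def atMost_atLeast0 add_2_eq_Suc')
  \<comment> \<open>The terms \<open>k = 0\<close> and \<open>k = n + 2\<close> both equal
    \<open>h (n + 2)\<close>, since \<open>h 0 = 1\<close>.\<close>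
  also have "\<dots> = 2 * h (n + 2) + (\<Sum>i\<le>n. h (Suc i) * h (Suc (n - i)))"
    by (subst sum.atMost_Suc, subst sum.atMost_Suc_shift)
      (auto simp: h_def Suc_diff_le intro!: sum.cong)
  finally have conv: "(\<Sum>i\<le>n. h (Suc i) * h (Suc (n - i))) = - 2 * h (n + 2)"
    by simp
  have "(\<Sum>i\<le>n. catalan i * catalan (n - i))
      = (\<Sum>i\<le>n. 4 * (- 4) ^ n * (h (Suc i) * h (Suc (n - i))))"
  proof (rule sum.cong)
    fix i assume "i \<in> {..n}"
    then have "(- 4 :: real) ^ n = (- 4) ^ i * (- 4) ^ (n - i)"
      by (simp flip: power_add)
    then show "catalan i * catalan (n - i) = 4 * (- 4) ^ n * (h (Suc i) * h (Suc (n - i)))"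
      by (simp add: catalan_gbinomial h_def)
  qed simp
  also have "\<dots> = catalan (Suc n)"
    by (simp add: conv catalan_gbinomial flip: sum_distrib_left) (simp add: h_def)
  finally show ?thesis by simp
qed

section \<open>Cutting words at a letter\<close>

text \<open>The first \<open>m\<close> in a word marks the cut, since \<open>u\<close> does not
  contain it. So \<open>i\<close>, \<open>u\<close> and \<open>v\<close> can be read off the word.
  Serves for cuts at the minimal and at the maximal letter.\<close>

lemma card_cut_words:
  assumes "\<And>i. i \<le> n \<Longrightarrow> finite (P i)" "\<And>i. i \<le> n \<Longrightarrow> finite (Q i)"
    and "\<And>i u. i \<le> n \<Longrightarrow> u \<in> P i \<Longrightarrow> length u = i \<and> m \<notin> set u"
  shows "card (\<Union>i\<le>n. (\<lambda>(u, v). u @ m # v) ` (P i \<times> Q i)) = (\<Sum>i\<le>n. card (P i) * card (Q i))"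
proof (subst card_UN_disjoint)
  let ?C = "\<lambda>i. (\<lambda>(u, v). u @ m # v) ` (P i \<times> Q i)"
  have "i = j" if "i \<le> n" "j \<le> n" "w \<in> ?C i" "w \<in> ?C j" for i j w
  proof -
    obtain u v u' v' where "u \<in> P i" "u' \<in> P j" "u @ m # v = u' @ m # v'"
      using \<open>w \<in> ?C i\<close> \<open>w \<in> ?C j\<close> by fastforce
    then show ?thesis
      using assms(3)[OF \<open>i \<le> n\<close>, of u] assms(3)[OF \<open>j \<le> n\<close>, of u']
      by (auto simp: append_eq_append_conv2 append_eq_Cons_conv Cons_eq_append_conv)
  qed
  then show "\<forall>i\<in>{..n}. \<forall>j\<in>{..n}. i \<noteq> j \<longrightarrow> ?C i \<inter> ?C j = {}"
    by blast
  have "inj_on (\<lambda>(u, v). u @ m # v) (P i \<times> Q i)" if "i \<le> n" for i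
    using assms(3)[OF that] by (auto simp: inj_on_def)
  then show "(\<Sum>i\<le>n. card (?C i)) = (\<Sum>i\<le>n. card (P i) * card (Q i))"
    by (simp add: card_image card_cartesian_product)
qed (use assms in auto)

text \<open>A discrete intermediate value property. Adjacent letters are wanted because inside a
  block \<open>hat\<close> sends each letter to the next one, so \<open>a\<close>, \<open>b\<close>
  will be an arrow.\<close>

lemma exists_crossing:
  fixes xs :: "'a::linorder list"
  assumes "x < y" "z \<in> set xs" "y < z" "y \<notin> set xs"
  shows "\<exists>us a b vs. x # xs = us @ a # b # vs \<and> a < y \<and> y < b"
  using assms
proof (induction xs arbitrary: x)
  case (Cons b xs)
  show ?case
  proof (cases "y < b")
    case True
    then show ?thesis using Cons.prems(1) by (metis append_Nil)
  next
    case False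
    then have "b < y" "z \<in> set xs" using Cons.prems by auto
    then show ?thesis using Cons.IH[of b] Cons.prems by (metis append_Cons list.set_intros(2))
  qed
qed simp

lemma subseq_pair_iff: "subseq [y, z] w \<longleftrightarrow> (\<exists>i j. i < j \<and> j < length w \<and> w ! i = y \<and> w ! j = z)"
proof
  assume "subseq [y, z] w"
  then obtain us vs where w: "w = us @ y # vs" "subseq [z] vs"
    by (auto dest: list_emb_ConsD)
  then obtain k where "k < length vs" "vs ! k = z"
    by (auto simp: subseq_singleton_left in_set_conv_nth)
  then show "\<exists>i j. i < j \<and> j < length w \<and> w ! i = y \<and> w ! j = z"
    using w(1) by (intro exI[of _ "length us"] exI[of _ "length us + Suc k"]) (simp add: nth_append)
next
  assume "\<exists>i j. i < j \<and> j < length w \<and> w ! i = y \<and> w ! j = z"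
  then obtain i j where ij: "i < j" "j < length w" "w ! i = y" "w ! j = z"
    by blast
  then have "w = take i w @ y # drop (Suc i) w"
    by (metis id_take_nth_drop order.strict_trans)
  moreover have "z \<in> set (drop (Suc i) w)"
    using ij by (auto simp: set_conv_nth intro!: exI[of _ "j - Suc i"])
  ultimately show "subseq [y, z] w"
    by (metis subseq_Cons2 subseq_drop_many subseq_singleton_left)
qed

lemma subseq_pairI: "y \<in> set u \<Longrightarrow> z \<in> set v \<Longrightarrow> subseq [y, z] (u @ v)"
  using list_emb_append_mono[of "(=)" "[y]" u "[z]" v] by (simp add: subseq_singleton_left)

lemma subseq_pairD:
  assumes "subseq [y, z] (u @ z # v)" "distinct (u @ z # v)"
  shows "y \<in> set u"
proof -
  obtain i j where ij: "i < j" "j < length (u @ z # v)" "(u @ z # v) ! i = y" "(u @ z # v) ! j = z"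
    using assms(1) by (auto simp: subseq_pair_iff)
  then have "j = length u"
    using assms(2) nth_eq_iff_index_eq[of "u @ z # v" j "length u"] by simp
  then show ?thesis using ij by (auto simp: nth_append)
qed

text \<open>Once one side of a cut lies below the other, the lengths alone determine the letters on
  both sides; this makes the pieces countable.\<close>

lemma initial_part_of_interval:
  fixes S T :: "nat set"
  assumes "S \<union> T = {a..<a + k}" "\<And>s t. s \<in> S \<Longrightarrow> t \<in> T \<Longrightarrow> s < t"
  shows "S = {a..<a + card S} \<and> T = {a + card S..<a + k}"
proof -
  have "finite T" "finite S"
    using assms(1) by (metis finite_Un finite_atLeastLessThan)+
  \<comment> \<open>The threshold between \<open>S\<close> and \<open>T\<close>; for empty
    \<open>T\<close> it is the end of the interval, which leaves everything to
    \<open>S\<close>.\<close>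
  define m where "m = (if T = {} then a + k else Min T)"
  have T: "t \<in> T \<Longrightarrow> m \<le> t" for t
    using \<open>finite T\<close> by (auto simp: m_def)
  have S: "s \<in> S \<Longrightarrow> s < m" for s
    using assms \<open>finite T\<close> by (auto simp: m_def)
  have m: "a \<le> m" "m \<le> a + k"
    using assms(1) Min_in[OF \<open>finite T\<close>] unfolding m_def
    by (metis UnI2 atLeastLessThan_iff le_add1 less_imp_le order_refl)+
  have "S = {a..<m}" "T = {m..<a + k}"
    using S T m assms(1) by (fastforce simp: set_eq_iff)+
  then show ?thesis using m by simp
qed

section \<open>Words avoiding 213\<close>

definition contains_213 :: "nat list \<Rightarrow> bool" where
  "contains_213 w \<longleftrightarrow> (\<exists>x y z. x < y \<and> y < z \<and> subseq [y, x, z] w)"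

text \<open>The letter set is arbitrary because the two sides of a cut live on different intervals;
  this takes the place of standardizing them.\<close>

definition avoiders_213 :: "nat set \<Rightarrow> nat list set" where
  "avoiders_213 A = {w \<in> permutations_of_set A. \<not> contains_213 w}"

lemma finite_avoiders_213 [simp]: "finite (avoiders_213 A)"
  by (simp add: avoiders_213_def)

lemma avoiders_213D: "w \<in> avoiders_213 A \<Longrightarrow> set w = A \<and> length w = card A"
  by (auto simp: avoiders_213_def permutations_of_set_def distinct_card)

text \<open>The minimum can only play the 1. Hence an occurrence that is not inside \<open>u\<close>
  or \<open>v\<close> has its 2 in \<open>u\<close> and its 3 in \<open>v\<close>; conversely
  \<open>x\<close> in \<open>u\<close> below \<open>y\<close> in \<open>v\<close> gives the
  occurrence \<open>x m y\<close>.\<close>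

lemma contains_213_cut_min:
  assumes "\<forall>x\<in>set u \<union> set v. m < x" "set u \<inter> set v = {}"
  shows "contains_213 (u @ m # v) \<longleftrightarrow>
    contains_213 u \<or> contains_213 v \<or> (\<exists>x\<in>set u. \<exists>y\<in>set v. x < y)"
proof
  assume "contains_213 (u @ m # v)"
  then obtain x y z where xyz: "x < y" "y < z" "subseq [y, x, z] (u @ m # v)"
    by (auto simp: contains_213_def)
  have "subseq [y, x, z] u \<or> subseq [y, x, z] v \<or> y \<in> set u \<and> z \<in> set v"
  proof -
    obtain p q where pq: "[y, x, z] = p @ q" "subseq p u" "subseq q (m # v)"
      using xyz(3) by (auto simp: subseq_append_iff)
    have ge: "m \<le> c" if "c \<in> set q" for c
      using list_emb_set[OF pq(3) that] assms(1) by (metis UnI2 order.refl less_imp_le set_ConsD)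
    \<comment> \<open>The part \<open>p\<close> inside \<open>u\<close> has length 0, length 1 or 2,
      or length 3.\<close>
    consider "p = []" "q = [y, x, z]" | "y \<in> set p" "z \<in> set q" | "p = [y, x, z]"
      using pq(1) by (auto simp: Cons_eq_append_conv)
    then show ?thesis
    proof cases
      case 1
      then have "y \<noteq> m" using ge[of x] xyz by auto
      then show ?thesis using 1 pq(3) by (simp split: if_splits)
    next
      case 2
      have "z \<noteq> m" "z \<in> set (m # v)" "y \<in> set u"
        using 2 list_emb_set[OF pq(2)] list_emb_set[OF pq(3)] xyz assms(1)
        by (metis UnI1 order.asym order.strict_trans, metis, metis)
      then show ?thesis by simp
    qed (use pq in simp)
  qed
  then show "contains_213 u \<or> contains_213 v \<or> (\<exists>x\<in>set u. \<exists>y\<in>set v. x < y)"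
    using xyz by (auto simp: contains_213_def)
next
  have "subseq [x, m, y] (u @ m # v)" if "x \<in> set u" "y \<in> set v" for x y
    using that list_emb_append_mono[of "(=)" "[x]" u "[m, y]" "m # v"]
    by (simp add: subseq_singleton_left)
  then show "contains_213 (u @ m # v)"
    if "contains_213 u \<or> contains_213 v \<or> (\<exists>x\<in>set u. \<exists>y\<in>set v. x < y)"
    using that assms(1) unfolding contains_213_def
    by (meson UnI1 list_emb_append2 list_emb_prefix list_emb_Cons)
qed

text \<open>By \<open>contains_213_cut_min\<close>, avoidance forces \<open>v\<close> below
  \<open>u\<close>. So a prefix of length \<open>i\<close> takes the top \<open>i\<close> values,
  and \<open>v\<close> the \<open>n - i\<close> values just above \<open>a\<close>.\<close>

lemma avoiders_213_Suc:
  "avoiders_213 {a..<a + Suc n} =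
    (\<Union>i\<le>n. (\<lambda>(u, v). u @ a # v) `
      (avoiders_213 {Suc a + (n - i)..<Suc a + n} \<times> avoiders_213 {Suc a..<Suc a + (n - i)}))"
  (is "?L = ?R")
proof (intro equalityI subsetI)
  fix w assume "w \<in> ?L"
  then have w: "set w = {a..<a + Suc n}" "distinct w" "\<not> contains_213 w"
    by (auto simp: avoiders_213_def permutations_of_set_def)
  then have "a \<in> set w" by simp
  then obtain u v where uv: "w = u @ a # v"
    by (meson split_list)
  \<comment> \<open>\<open>set v\<close> comes first, as the lower part in
    \<open>initial_part_of_interval\<close>.\<close>
  have "set v \<union> set u = set w - {a}"
    using w(2) uv by auto
  also have "\<dots> = {Suc a..<Suc a + n}"
    unfolding w(1) by auto
  finally have sets: "set v \<union> set u = {Suc a..<Suc a + n}" .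
  have gt: "\<forall>x\<in>set u \<union> set v. a < x"
    unfolding Un_commute[of "set u"] sets by auto
  have disj: "set u \<inter> set v = {}" "distinct u" "distinct v"
    using w(2) uv by auto
  note no = w(3)[unfolded uv contains_213_cut_min[OF gt disj(1)]]
  have lt: "x < y" if "x \<in> set v" "y \<in> set u" for x y
    using no that disj(1) by (metis IntI empty_iff linorder_neqE)
  have "length w = Suc n"
    using distinct_card[OF w(2)] w(1) by simp
  then have len: "card (set v) = n - length u" "length u \<le> n"
    using distinct_card[OF disj(3)] uv by simp_all
  note part = initial_part_of_interval[OF sets lt, unfolded len(1)]
  have "u \<in> avoiders_213 {Suc a + (n - length u)..<Suc a + n}"
    "v \<in> avoiders_213 {Suc a..<Suc a + (n - length u)}"
    using part no disj by (simp_all add: avoiders_213_def permutations_of_set_def)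
  then show "w \<in> ?R"
    using uv len(2) by (intro UN_I[of "length u"] image_eqI[of _ _ "(u, v)"]) simp_all
next
  fix w assume "w \<in> ?R"
  then obtain i u v where "i \<le> n" "w = u @ a # v"
    "u \<in> avoiders_213 {Suc a + (n - i)..<Suc a + n}" "v \<in> avoiders_213 {Suc a..<Suc a + (n - i)}"
    by auto
  moreover from this have "\<not> contains_213 (u @ a # v)"
    by (subst contains_213_cut_min) (auto simp: avoiders_213_def permutations_of_set_def)
  ultimately show "w \<in> ?L"
    by (auto simp: avoiders_213_def permutations_of_set_def)
qed

text \<open>The start \<open>a\<close> varies in the induction, since the pieces of a cut start
  elsewhere.\<close>

lemma card_avoiders_213: "real (card (avoiders_213 {a..<a + n})) = catalan n"
proof (induction n arbitrary: a rule: less_induct)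
  case (less n)
  show ?case
  proof (cases n)
    case 0
    then show ?thesis
      by (simp add: avoiders_213_def contains_213_def Collect_conv_if cong: conj_cong)
  next
    case (Suc k)
    have card: "real (card (avoiders_213 {Suc a + (k - i)..<Suc a + k})) = catalan i"
      "real (card (avoiders_213 {Suc a..<Suc a + (k - i)})) = catalan (k - i)" if "i \<le> k" for i
      using that less.IH[of i "Suc a + (k - i)"] less.IH[of "k - i" "Suc a"] Suc by auto
    have "card (avoiders_213 {a..<a + Suc k}) = (\<Sum>i\<le>k.
        card (avoiders_213 {Suc a + (k - i)..<Suc a + k}) * card (avoiders_213 {Suc a..<Suc a + (k - i)}))"
      unfolding avoiders_213_Suc
      by (rule card_cut_words) (auto dest: avoiders_213D)
    then have "real (card (avoiders_213 {a..<a + Suc k})) = (\<Sum>i\<le>k. catalan i * catalan (k - i))"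
      by (simp only: of_nat_sum of_nat_mult) (intro sum.cong refl, simp only: card atMost_iff)
    then show ?thesis
      by (simp only: Suc catalan_Suc)
  qed
qed

section \<open>The cycle structure of a word\<close>

text \<open>The largest letter opens a block that no later letter ends. Earlier blocks are
  unaffected, because each of them stops at \<open>m\<close> at the latest.\<close>

lemma lr_max_blocks_cut_max:
  assumes "\<forall>x\<in>set u \<union> set v. x < m"
  shows "lr_max_blocks (u @ m # v) = lr_max_blocks u @ [m # v]"
  using assms
proof (induction u rule: lr_max_blocks.induct)
  case 1
  then have "takeWhile (\<lambda>y. y < m) v = v" "dropWhile (\<lambda>y. y < m) v = []"
    by (simp_all add: dropWhile_eq_Nil_conv)
  then show ?case
    by (simp del: dropWhile_eq_Nil_conv takeWhile_eq_all_conv)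
next
  case (2 x xs)
  have "takeWhile (\<lambda>y. y < x) (xs @ m # v) = takeWhile (\<lambda>y. y < x) xs"
    "dropWhile (\<lambda>y. y < x) (xs @ m # v) = dropWhile (\<lambda>y. y < x) xs @ m # v"
    using 2 by (auto simp: takeWhile_append dropWhile_append takeWhile_eq_all_conv[THEN iffD2])
  moreover have "\<forall>y\<in>set (dropWhile (\<lambda>y. y < x) xs) \<union> set v. y < m"
    using 2 by (auto dest: set_dropWhileD)
  ultimately show ?case using 2 by simp
qed

lemma concat_lr_max_blocks [simp]: "concat (lr_max_blocks w) = w"
  by (induction w rule: lr_max_blocks.induct) auto

lemma hat_permutes: "hat w permutes set w"
proof -
  have "foldr (\<lambda>c f. cycle_of_list c \<circ> f) bs id permutes set (concat bs)" for bs :: "nat list list"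
  proof (induction bs)
    case (Cons b bs)
    have "foldr (\<lambda>c f. cycle_of_list c \<circ> f) bs id permutes set (concat (b # bs))"
      by (rule permutes_subset[OF Cons.IH]) simp
    moreover have "cycle_of_list b permutes set (concat (b # bs))"
      by (rule permutes_subset[OF cycle_permutes]) simp
    ultimately show ?case
      by (simp only: foldr.simps comp_apply[of _ _ id] permutes_compose)
  qed (simp add: fun_eq_iff)
  then show ?thesis
    by (metis hat_def concat_lr_max_blocks)
qed

lemma hat_cut_max:
  assumes "\<forall>x\<in>set u \<union> set v. x < m"
  shows "hat (u @ m # v) = hat u \<circ> cycle_of_list (m # v)"
proof -
  \<comment> \<open>Pulling the start value out of the fold turns the last block into the right
    factor of the composition.\<close>
  have "foldr (\<lambda>c f. cycle_of_list c \<circ> f) bs g = foldr (\<lambda>c f. cycle_of_list c \<circ> f) bs id \<circ> g"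
    for bs and g :: "nat \<Rightarrow> nat"
    by (induction bs) auto
  from this[of "lr_max_blocks u" "cycle_of_list (m # v)"] show ?thesis
    by (simp add: hat_def lr_max_blocks_cut_max[OF assms])
qed

text \<open>Mapping a cycle over its own list rotates the list by one place; the claim is read off
  at the position of \<open>a\<close>.\<close>

lemma cycle_of_list_next:
  assumes "distinct (us @ a # b # vs)"
  shows "cycle_of_list (us @ a # b # vs) a = b"
proof -
  let ?cs = "us @ a # b # vs"
  have "map (cycle_of_list ?cs) ?cs ! length us = rotate1 ?cs ! length us"
    using cyclic_rotation[OF assms, of 1] by simp
  then show ?thesis
    by (simp add: nth_rotate1 nth_append del: rotate1.simps)
qed

lemma cycle_of_list_last:
  assumes "distinct cs" "cs \<noteq> []"
  shows "cycle_of_list cs (last cs) = hd cs"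
proof -
  have "map (cycle_of_list cs) cs ! (length cs - 1) = rotate1 cs ! (length cs - 1)"
    using cyclic_rotation[OF assms(1), of 1] by simp
  then show ?thesis
    using assms(2) by (simp add: nth_rotate1 last_conv_nth hd_conv_nth)
qed

lemma hat_cut_max_left:
  assumes "\<forall>x\<in>set u \<union> set v. x < m" "distinct (u @ m # v)" "x \<in> set u"
  shows "hat (u @ m # v) x = hat u x"
proof -
  have "x \<notin> set (m # v)" using assms(2,3) by auto
  then show ?thesis by (simp add: hat_cut_max[OF assms(1)] id_outside_supp del: cycle_of_list.simps)
qed

text \<open>The cycle keeps \<open>x\<close> inside its own block, and \<open>hat u\<close> fixes
  everything outside \<open>u\<close>.\<close>

lemma hat_cut_max_right:
  assumes "\<forall>x\<in>set u \<union> set v. x < m" "distinct (u @ m # v)" "x \<in> set (m # v)"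
  shows "hat (u @ m # v) x = cycle_of_list (m # v) x"
proof -
  have "cycle_of_list (m # v) x \<in> set (m # v)"
    using assms(3) by (simp only: permutes_in_image[OF cycle_permutes])
  then have "cycle_of_list (m # v) x \<notin> set u" using assms(2) by auto
  then show ?thesis
    by (simp add: hat_cut_max[OF assms(1)] permutes_not_in[OF hat_permutes] del: cycle_of_list.simps)
qed

section \<open>Words avoiding the arrow pattern\<close>

text \<open>The pattern (23; 1 -> 3) in terms of letters instead of positions and enumerations, so
  that it also makes sense for the pieces of a cut.\<close>

definition contains_arrow :: "nat list \<Rightarrow> bool" where
  "contains_arrow w \<longleftrightarrow> (\<exists>x y z. x \<in> set w \<and> x < y \<and> y < z \<and> subseq [y, z] w \<and> hat w x = z)"

text \<open>Arrows that start in \<open>u\<close> are those of \<open>hat u\<close>; arrows that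
  start in \<open>v\<close> are described by \<open>next_hat\<close> and
  \<open>last_hat\<close>.\<close>

lemma contains_arrow_cut_max:
  assumes lt: "\<forall>x\<in>set u \<union> set v. x < m" and dist: "distinct (u @ m # v)"
  shows "contains_arrow (u @ m # v) \<longleftrightarrow>
    contains_arrow u \<or> contains_213 v \<or> (\<exists>s\<in>set u. \<exists>t\<in>set v. t < s)"
proof
  let ?w = "u @ m # v"
  have next_hat: "hat ?w a = b" if "v = us @ a # b # vs" for us a b vs
    using that cycle_of_list_next[of "m # us" a b vs] hat_cut_max_right[OF assms, of a] dist by auto
  have last_hat: "hat ?w (last v) = m" if "v \<noteq> []"
    using that cycle_of_list_last[of "m # v"] hat_cut_max_right[OF assms, of "last v"] dist by auto
  show "contains_arrow ?w" if "contains_arrow u \<or> contains_213 v \<or> (\<exists>s\<in>set u. \<exists>t\<in>set v. t < s)"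
    using that
  proof (elim disjE bexE)
    assume "contains_arrow u"
    then show ?thesis
      unfolding contains_arrow_def using hat_cut_max_left[OF assms]
      by (metis UnI1 list_emb_prefix set_append)
  next
    assume "contains_213 v"
    then obtain x y z where xyz: "x < y" "y < z" "subseq [y, x, z] v"
      by (auto simp: contains_213_def)
    then obtain v1 v2 where v: "v = v1 @ y # v2" "subseq [x, z] v2"
      by (auto dest: list_emb_ConsD)
    then obtain v3 v4 where v2: "v2 = v3 @ x # v4" "z \<in> set v4"
      by (auto dest: list_emb_ConsD simp: subseq_singleton_left)
    \<comment> \<open>From \<open>x\<close> on, the word climbs from below \<open>y\<close> to above
      it. A crossing \<open>a\<close>, \<open>b\<close> gives the occurrence \<open>a\<close>,
      \<open>y\<close>, \<open>b\<close>, since \<open>y\<close> precedes \<open>x\<close> and hence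
      \<open>b\<close>.\<close>
    obtain us a b vs where *: "x # v4 = us @ a # b # vs" "a < y" "y < b"
      using exists_crossing[OF \<open>x < y\<close> v2(2) \<open>y < z\<close>] dist v v2 by auto
    have v': "v = (v1 @ y # v3 @ us) @ a # b # vs"
      using v(1) v2(1) *(1) by simp
    have "hat ?w a = b" "a \<in> set ?w" "subseq [y, b] ?w"
      using next_hat[OF v'] subseq_pairI[of y "u @ m # v1 @ y # v3 @ us @ [a]" b "b # vs"] v' by auto
    then show ?thesis
      using * unfolding contains_arrow_def by blast
  next
    fix s t assume st: "s \<in> set u" "t \<in> set v" "t < s"
    then have "v \<noteq> []" by auto
    have sv: "s \<notin> set v" using dist st by auto
    show ?thesis
    proof (cases "last v < s")
      case True
      \<comment> \<open>The occurrence is \<open>last v\<close>, \<open>s\<close>, \<open>m\<close>: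
        the cycle closes from \<open>last v\<close> to \<open>m\<close>.\<close>
      have "subseq [s, m] ?w"
        using subseq_pairI[of s u m "m # v"] st(1) by simp
      then show ?thesis
        using True last_hat \<open>v \<noteq> []\<close> lt st(1) unfolding contains_arrow_def
        by (metis UnCI append_is_Nil_conv last_in_set set_append list.set_intros(2))
    next
      case False
      then have "s < last v" using sv \<open>v \<noteq> []\<close> by (metis last_in_set linorder_neqE)
      obtain v1 v2 where v: "v = v1 @ t # v2"
        using st(2) by (meson split_list)
      have "last v \<in> set v2"
        using v \<open>s < last v\<close> st(3) by (auto split: if_splits)
      \<comment> \<open>From \<open>t\<close> on, \<open>v\<close> has to pass the value
        \<open>s\<close> to reach \<open>last v\<close>; the crossing \<open>a\<close>,
        \<open>b\<close> gives the occurrence \<open>a\<close>, \<open>s\<close>,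
        \<open>b\<close>.\<close>
      then obtain us a b vs where *: "t # v2 = us @ a # b # vs" "a < s" "s < b"
        using exists_crossing[OF \<open>t < s\<close> _ \<open>s < last v\<close>, of v2] sv v by auto
      have v': "v = (v1 @ us) @ a # b # vs"
        using v *(1) by simp
      have "hat ?w a = b" "a \<in> set ?w" "subseq [s, b] ?w"
        using next_hat[OF v'] subseq_pairI[of s "u @ m # v1 @ us @ [a]" b "b # vs"] st(1) v' by auto
      then show ?thesis
        using * unfolding contains_arrow_def by blast
    qed
  qed
  assume "contains_arrow ?w"
  then obtain x y z where xyz: "x \<in> set ?w" "x < y" "y < z" "subseq [y, z] ?w" "hat ?w x = z"
    by (auto simp: contains_arrow_def)
  have z: "z \<in> set ?w"
    using subseq_Cons'[OF xyz(4)] by (simp only: subseq_singleton_left)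
  then have "z \<le> m"
    using lt by (auto simp: less_imp_le)
  \<comment> \<open>The tail \<open>x\<close> of the arrow decides: from \<open>u\<close> the arrow
    stays in \<open>u\<close>; \<open>m\<close> is not below \<open>z\<close>; from \<open>v\<close>
    it leads to the next letter or, at the end, to \<open>m\<close>.\<close>
  consider "x \<in> set u" | "x = m" | "x \<in> set v"
    using xyz(1) by auto
  then show "contains_arrow u \<or> contains_213 v \<or> (\<exists>s\<in>set u. \<exists>t\<in>set v. t < s)"
  proof cases
    case 1
    then have hat: "hat u x = z"
      using hat_cut_max_left[OF assms] xyz(5) by simp
    then have "z \<in> set u"
      using 1 permutes_in_image[OF hat_permutes, of u x] by simp
    then obtain p q where u: "u = p @ z # q"
      by (meson split_list)
    \<comment> \<open>By distinctness \<open>z\<close> occurs only here, so \<open>y\<close> comes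
      before it within \<open>u\<close>.\<close>
    then have "y \<in> set p"
      using subseq_pairD[of y z p "q @ m # v"] xyz(4) dist by simp
    then have "subseq [y, z] u"
      using subseq_pairI[of y p z "z # q"] u by simp
    then show ?thesis
      using 1 hat xyz unfolding contains_arrow_def by blast
  next
    case 2
    then show ?thesis using xyz \<open>z \<le> m\<close> by simp
  next
    case 3
    then obtain v1 v2 where v: "v = v1 @ x # v2"
      by (meson split_list)
    show ?thesis
    proof (cases v2)
      case Nil
      then have "z = m"
        using v last_hat xyz(5) by simp
      \<comment> \<open>The letters before \<open>m\<close> are exactly those of \<open>u\<close>,
        so \<open>y\<close> in \<open>u\<close> exceeds \<open>x\<close> in
        \<open>v\<close>.\<close>
      then have "y \<in> set u"
        using subseq_pairD[of y m u v] xyz(4) dist by simp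
      then show ?thesis using 3 xyz(2) by blast
    next
      case (Cons b v3)
      then have "z = b"
        using v next_hat xyz(5) by simp
      then have "y \<in> set (u @ m # v1 @ [x])"
        using subseq_pairD[of y z "u @ m # v1 @ [x]" v3] xyz(4) dist v Cons by simp
      \<comment> \<open>\<open>y\<close> is neither \<open>x\<close> nor \<open>m\<close>, as
        \<open>x < y < z \<le> m\<close>. In \<open>u\<close> it exceeds \<open>x\<close>; in
        \<open>v1\<close> it completes the 213 occurrence \<open>y x z\<close>.\<close>
      then consider "y \<in> set u" | "y \<in> set v1"
        using xyz \<open>z \<le> m\<close> by auto
      then show ?thesis
      proof cases
        case 1
        then show ?thesis using 3 xyz(2) by blast
      next
        case 2
        then have "subseq [y, x, z] v"
          using list_emb_append_mono[of "(=)" "[y]" v1 "[x, z]" "x # v2"] v Cons \<open>z = b\<close>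
          by (simp add: subseq_singleton_left)
        then show ?thesis using xyz unfolding contains_213_def by blast
      qed
    qed
  qed
qed

lemma contains_pattern_iff:
  assumes "w \<in> permutations_of_set {1..n}"
  shows "contains_pattern w ([2, 3], {(1, 3)}) \<longleftrightarrow> contains_arrow w"
proof -
  have w: "set w = {1..n}" "length w = n"
    using assms distinct_card[of w] by (auto simp: permutations_of_set_def)
  have size: "pattern_size ([2, 3], {(1, 3)}) = 3"
    by (simp add: pattern_size_def card_insert_if)
  have sets: "{1..3} = {1, 2, 3 :: nat}" "{..<2} = {0, 1 :: nat}"
    by auto
  show ?thesis
  proof
    assume "contains_pattern w ([2, 3], {(1, 3)})"
    then obtain x t where xt: "strict_mono_on {1..3 :: nat} x" "x ` {1..3 :: nat} \<subseteq> {1..n}"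
      "strict_mono_on {..<2} t" "t ` {..<2} \<subseteq> {..<n}"
      "\<forall>j<2. w ! t j = x ([2, 3] ! j)" "hat w (x 1) = x 3"
      unfolding contains_pattern.simps size w(2) by (auto simp: numeral_2_eq_2)
    have "subseq [x 2, x 3] w"
      unfolding subseq_pair_iff
      using xt(3-5) w(2) by (intro exI[of _ "t 0"] exI[of _ "t 1"]) (auto simp: sets strict_mono_on_def)
    moreover have "x 1 < x 2" "x 2 < x 3" "x 1 \<in> set w"
      using xt(1) image_subset_iff[THEN iffD1, OF xt(2)] w(1) by (auto simp: strict_mono_on_def)
    ultimately show "contains_arrow w"
      using xt(6) unfolding contains_arrow_def by blast
  next
    assume "contains_arrow w"
    then obtain x y z i j where *: "x \<in> set w" "x < y" "y < z" "hat w x = z"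
      "i < j" "j < length w" "w ! i = y" "w ! j = z"
      unfolding contains_arrow_def subseq_pair_iff by blast
    \<comment> \<open>\<open>y\<close> lies between \<open>x\<close> and \<open>z\<close>, so these
      bounds keep all three letters in range.\<close>
    have bounds: "1 \<le> x" "z \<le> length w"
      using *(1) nth_mem[OF *(6)] unfolding *(8) w by auto
    define x' t where "x' = (\<lambda>k :: nat. if k = 1 then x else if k = 2 then y else z)"
      and "t = (\<lambda>k :: nat. if k = 0 then i else j)"
    have "strict_mono_on {1..3} x'"
      using *(2,3) by (auto simp: x'_def strict_mono_on_def)
    moreover have "x' ` {1..3} \<subseteq> {1..length w}"
      using *(2,3) bounds by (auto simp: x'_def)
    moreover have "strict_mono_on {..<length [2, 3 :: nat]} t"
      using *(5) by (auto simp: t_def strict_mono_on_def)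
    moreover have "t ` {..<length [2, 3 :: nat]} \<subseteq> {..<length w}"
      using *(5,6) by (auto simp: t_def)
    moreover have "\<forall>k<length [2, 3 :: nat]. w ! t k = x' ([2, 3] ! k)"
      using *(7,8) by (auto simp: x'_def t_def less_Suc_eq)
    moreover have "\<forall>(b, c)\<in>{(1, 3)}. hat w (x' b) = x' c"
      using *(4) by (simp add: x'_def)
    ultimately show "contains_pattern w ([2, 3], {(1, 3)})"
      unfolding contains_pattern.simps size by blast
  qed
qed

section \<open>Decomposition and enumeration of the arrow avoiders\<close>

definition avoiders_arrow :: "nat \<Rightarrow> nat list set" where
  "avoiders_arrow n = {w \<in> permutations_of_set {1..<1 + n}. \<not> contains_arrow w}"

lemma finite_avoiders_arrow [simp]: "finite (avoiders_arrow n)"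
  by (simp add: avoiders_arrow_def)

lemma avoiders_arrowD: "w \<in> avoiders_arrow n \<Longrightarrow> set w = {1..<1 + n} \<and> length w = n"
  using distinct_card[of w] by (auto simp: avoiders_arrow_def permutations_of_set_def)

text \<open>By \<open>contains_arrow_cut_max\<close>, now \<open>u\<close> lies below
  \<open>v\<close>, so \<open>u\<close> is again a permutation of an initial segment. The half-open
  intervals fit \<open>initial_part_of_interval\<close> with \<open>a = 1\<close>, and
  \<open>1 + i + (n - i)\<close> fits \<open>card_avoiders_213\<close>.\<close>

lemma avoiders_arrow_Suc:
  "avoiders_arrow (Suc n) =
    (\<Union>i\<le>n. (\<lambda>(u, v). u @ Suc n # v) ` (avoiders_arrow i \<times> avoiders_213 {1 + i..<1 + i + (n - i)}))"
  (is "?L = ?R")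
proof (intro equalityI subsetI)
  fix w assume "w \<in> ?L"
  then have w: "set w = {1..<1 + Suc n}" "distinct w" "\<not> contains_arrow w"
    by (auto simp: avoiders_arrow_def permutations_of_set_def)
  then have "Suc n \<in> set w" by simp
  then obtain u v where uv: "w = u @ Suc n # v"
    by (meson split_list)
  have "set u \<union> set v = set w - {Suc n}"
    using w(2) uv by auto
  also have "\<dots> = {1..<1 + n}"
    unfolding w(1) by auto
  finally have sets: "set u \<union> set v = {1..<1 + n}" .
  have less: "\<forall>x\<in>set u \<union> set v. x < Suc n"
    unfolding sets by auto
  have disj: "set u \<inter> set v = {}" "distinct u" "distinct v"
    using w(2) uv by auto
  note no = w(3)[unfolded uv contains_arrow_cut_max[OF less w(2)[unfolded uv]]]
  have lt: "x < y" if "x \<in> set u" "y \<in> set v" for x y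
    using no that disj(1) by (metis IntI empty_iff linorder_neqE)
  have "length w = Suc n"
    using distinct_card[OF w(2)] w(1) by simp
  then have len: "card (set u) = length u" "length u \<le> n"
    using distinct_card[OF disj(2)] uv by simp_all
  note part = initial_part_of_interval[OF sets lt, unfolded len(1)]
  have "u \<in> avoiders_arrow (length u)"
    "v \<in> avoiders_213 {1 + length u..<1 + length u + (n - length u)}"
    using part no disj len(2) by (simp_all add: avoiders_213_def avoiders_arrow_def permutations_of_set_def)
  then show "w \<in> ?R"
    using uv len(2) by (intro UN_I[of "length u"] image_eqI[of _ _ "(u, v)"]) simp_all
next
  fix w assume "w \<in> ?R"
  then obtain i u v where "i \<le> n" "w = u @ Suc n # v"
    "u \<in> avoiders_arrow i" "v \<in> avoiders_213 {1 + i..<1 + i + (n - i)}"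
    by auto
  moreover from this have "\<not> contains_arrow (u @ Suc n # v)"
    by (subst contains_arrow_cut_max) (auto simp: avoiders_213_def avoiders_arrow_def permutations_of_set_def)
  ultimately show "w \<in> ?L"
    by (auto simp: avoiders_213_def avoiders_arrow_def permutations_of_set_def)
qed

lemma card_avoiders_arrow: "real (card (avoiders_arrow n)) = catalan n"
proof (induction n rule: less_induct)
  case (less n)
  show ?case
  proof (cases n)
    case 0
    then show ?thesis
      by (simp add: avoiders_arrow_def contains_arrow_def Collect_conv_if cong: conj_cong)
  next
    case (Suc k)
    have "card (avoiders_arrow (Suc k)) =
        (\<Sum>i\<le>k. card (avoiders_arrow i) * card (avoiders_213 {1 + i..<1 + i + (k - i)}))"
      unfolding avoiders_arrow_Suc
      by (rule card_cut_words) (auto dest: avoiders_arrowD)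
    then have "real (card (avoiders_arrow (Suc k))) = (\<Sum>i\<le>k. catalan i * catalan (k - i))"
      \<comment> \<open>The suffixes are counted by \<open>card_avoiders_213\<close>, the prefixes
        by the induction hypothesis.\<close>
      by (simp only: of_nat_sum of_nat_mult card_avoiders_213)
        (intro sum.cong refl, simp add: less.IH Suc)
    then show ?thesis
      by (simp only: Suc catalan_Suc)
  qed
qed

theorem theorem5p4:
  fixes n :: nat
  assumes "n \<ge> 1"
  shows "real (card (avoiders n ([2, 3], {(1, 3)}))) = catalan n"
proof -
  have "{1..<1 + n} = {1..n}"
    by auto
  then have "avoiders n ([2, 3], {(1, 3)}) = avoiders_arrow n"
    unfolding avoiders_def avoiders_arrow_def using contains_pattern_iff by metis
  then show ?thesis
    by (simp add: card_avoiders_arrow)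
qed

end
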